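(* Let $\mu,\nu\in\mathcal P_1$ with $\mu\preccurlyeq\nu$. The operator $\mathbb S$ exchanges left-monotone and right-monotone transference plans, i.e. $$\mathbb S\big(Q_R(S(\mu),S(\nu))\big)=Q_L(\mu,\nu)\qquad\text{and}\qquad \mathbb S\big(Q_L(S(\mu),S(\nu))\big)=Q_R(\mu,\nu).$$
   Context: Notation: $\mathbb R_+^*=(0,\infty)$. $\mathcal P_1$ is the set of Borel probability measures $\mu$ on $\mathbb R_+^*$ with $\int x\,\mu(dx)=1$. $\mu\preccurlyeq\nu$ (convex order) means $\int f\,d\mu\le\int f\,d\nu$ for all convex $f:\mathbb R_+^*\to\mathbb R$. On $(\mathbb R_+^* )^2$ let $X,Y$ be the coordinate maps. $\mathcal M(\mu,\nu)$ is the set of probability measures $Q$ on $(\mathbb R_+^* )^2$ such that under $Q$: $X\sim\mu$, $Y\sim\nu$, and $\mathbb E^Q[Y\mid X]=X$. Symmetry operators: for $\mu\in\mathcal P_1$, $S(\mu)\in\mathcal P_1$ is the law of $x\mapsto 1/x$ under $\bar\mu(dx)=x\,\mu(dx)$, i.e. $\int f\,dS(\mu)=\int x f(1/x)\,\mu(dx)$ for bounded measurable $f$. For $Q\in\mathcal M(\mu,\nu)$, $\mathbb S(Q)$ is the measure on $(\mathbb R_+^* )^2$ defined by $\mathbb E^{\mathbb S(Q)}[f(X,Y)]=\mathbb E^Q[Yf(1/X,1/Y)]$ for all bounded measurable $f$. ($S$ preserves the convex order, so the plans for the marginals $S(\mu),S(\nu)$ are well defined.) A measure $Q\in\mathcal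 M(\mu,\nu)$ is left-monotone (resp. right-monotone) if there exists a Borel set $\Gamma\subset(\mathbb R_+^* )^2$ with $Q(\Gamma)=1$ such that for all $(x,y^-),(x,y^+),(x',y')\in\Gamma$ one cannot have $x<x'$ and $y^-<y'<y^+$ (resp. $x>x'$ and $y^-<y'<y^+$). By a theorem of Beiglböck and Juillet, for marginals in convex order there exist a unique left-monotone and a unique right-monotone element of $\mathcal M(\mu,\nu)$; they are denoted $Q_L(\mu,\nu)$ and $Q_R(\mu,\nu)$ respectively. *)

theory Defs
  imports "HOL-Probability.Probability"
begin

definition Rpos :: "real measure" where
  "Rpos = restrict_space borel {0<..}"

definition Rpos2 :: "(real \<times> real) measure" where
  "Rpos2 = restrict_space borel ({0<..} \<times> {0<..})"

definition P1 :: "real measure set" where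
  "P1 = {\<mu>. prob_space \<mu> \<and> sets \<mu> = sets Rpos \<and> has_bochner_integral \<mu> (\<lambda>x. x) 1}"

text \<open>
  A convex function on \<open>(0,\<infinity>)\<close> is bounded below by an affine function, so for \<open>\<mu> \<in> P1\<close> its
  integral always exists in \<open>(-\<infinity>,\<infinity>]\<close> but may be \<open>\<infinity>\<close>. The Bochner integral would
  silently be \<open>0\<close> in that case, hence the extended integral (the case \<open>\<infinity> - \<infinity>\<close> does
  not arise for \<open>\<mu> \<in> P1\<close>).
\<close>

definition ext_integral :: "real measure \<Rightarrow> (real \<Rightarrow> real) \<Rightarrow> ereal" where
  "ext_integral \<mu> f =
     enn2ereal (\<integral>\<^sup>+ x. ennreal (f x) \<partial>\<mu>) - enn2ereal (\<integral>\<^sup>+ x. ennreal (- f x) \<partial>\<mu>)"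

definition convex_order :: "real measure \<Rightarrow> real measure \<Rightarrow> bool" (infix \<open>\<preceq>\<^sub>c\<close> 50) where
  "\<mu> \<preceq>\<^sub>c \<nu> \<longleftrightarrow> (\<forall>f. convex_on {0<..} f \<longrightarrow> ext_integral \<mu> f \<le> ext_integral \<nu> f)"

definition martingale_plans :: "real measure \<Rightarrow> real measure \<Rightarrow> (real \<times> real) measure set" where
  "martingale_plans \<mu> \<nu> =
     {Q. prob_space Q \<and> sets Q = sets Rpos2 \<and>
         distr Q Rpos fst = \<mu> \<and> distr Q Rpos snd = \<nu> \<and>
         (AE z in Q. real_cond_exp Q (vimage_algebra (space Q) fst Rpos) snd z = fst z)}"

definition sym_measure :: "real measure \<Rightarrow> real measure" where
  "sym_measure \<mu> = distr (density \<mu> (\<lambda>x. ennreal x)) Rpos (\<lambda>x. 1 / x)"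

definition sym_plan :: "(real \<times> real) measure \<Rightarrow> (real \<times> real) measure" where
  "sym_plan Q =
     distr (density Q (\<lambda>(x, y). ennreal y)) Rpos2 (\<lambda>(x, y). (1 / x, 1 / y))"

definition left_monotone :: "(real \<times> real) measure \<Rightarrow> bool" where
  "left_monotone Q \<longleftrightarrow>
     (\<exists>\<Gamma>\<in>sets Rpos2. emeasure Q \<Gamma> = 1 \<and>
        (\<forall>x ym yp x' y'. (x, ym) \<in> \<Gamma> \<and> (x, yp) \<in> \<Gamma> \<and> (x', y') \<in> \<Gamma> \<longrightarrow>
           \<not> (x < x' \<and> ym < y' \<and> y' < yp)))"

definition right_monotone :: "(real \<times> real) measure \<Rightarrow> bool" where
  "right_monotone Q \<longleftrightarrow>
     (\<exists>\<Gamma>\<in>sets Rpos2. emeasure Q \<Gamma> = 1 \<and>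
        (\<forall>x ym yp x' y'. (x, ym) \<in> \<Gamma> \<and> (x, yp) \<in> \<Gamma> \<and> (x', y') \<in> \<Gamma> \<longrightarrow>
           \<not> (x > x' \<and> ym < y' \<and> y' < yp)))"

text \<open>
  By the theorem of Beiglboeck and Juillet the plans below exist and are unique whenever
  \<open>\<mu>, \<nu> \<in> P1\<close> and \<open>\<mu> \<preceq>\<^sub>c \<nu>\<close>, so the \<open>else\<close> branch is only a convention
  outside that domain.
\<close>

definition Q_L :: "real measure \<Rightarrow> real measure \<Rightarrow> (real \<times> real) measure" where
  "Q_L \<mu> \<nu> =
     (if \<exists>!Q. Q \<in> martingale_plans \<mu> \<nu> \<and> left_monotone Q
      then THE Q. Q \<in> martingale_plans \<mu> \<nu> \<and> left_monotone Q
      else null_measure Rpos2)"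

definition Q_R :: "real measure \<Rightarrow> real measure \<Rightarrow> (real \<times> real) measure" where
  "Q_R \<mu> \<nu> =
     (if \<exists>!Q. Q \<in> martingale_plans \<mu> \<nu> \<and> right_monotone Q
      then THE Q. Q \<in> martingale_plans \<mu> \<nu> \<and> right_monotone Q
      else null_measure Rpos2)"

text \<open>The integral identities characterising the two symmetry operators.\<close>

lemma integral_sym_measure:
  fixes f :: "real \<Rightarrow> real"
  assumes "sets \<mu> = sets Rpos" and f: "f \<in> borel_measurable Rpos"
  shows "(\<integral>x. f x \<partial>sym_measure \<mu>) = (\<integral>x. x * f (1 / x) \<partial>\<mu>)"
proof -
  have inv: "(\<lambda>x. 1 / x) \<in> measurable Rpos Rpos"
    unfolding Rpos_def
    by (intro measurable_restrict_space3) auto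
  have sp: "space \<mu> = {0<..}"
    using sets_eq_imp_space_eq[OF assms(1)] by (simp add: Rpos_def space_restrict_space)
  have inv': "(\<lambda>x. 1 / x) \<in> measurable \<mu> Rpos"
    using inv measurable_cong_sets[OF assms(1) refl] by blast
  have id: "(\<lambda>x. x) \<in> borel_measurable \<mu>"
    unfolding measurable_cong_sets[OF assms(1) refl] Rpos_def
    by (intro measurable_restrict_space1) simp
  have fm: "(\<lambda>x. f (1 / x)) \<in> borel_measurable \<mu>"
    using measurable_compose[OF inv' f] .
  have pos: "AE x in \<mu>. 0 \<le> x"
    by (rule AE_I2) (simp add: sp)
  have "(\<integral>x. f x \<partial>sym_measure \<mu>) = (\<integral>x. f (1 / x) \<partial>density \<mu> (\<lambda>x. ennreal x))"
    unfolding sym_measure_def using inv' f by (intro integral_distr) auto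
  also have "\<dots> = (\<integral>x. x * f (1 / x) \<partial>\<mu>)"
    using integral_density[OF fm id pos] by simp
  finally show ?thesis .
qed

lemma integral_sym_plan:
  fixes f :: "real \<times> real \<Rightarrow> real"
  assumes "sets Q = sets Rpos2" and f: "f \<in> borel_measurable Rpos2"
  shows "(\<integral>z. f z \<partial>sym_plan Q) = (\<integral>z. snd z * f (1 / fst z, 1 / snd z) \<partial>Q)"
proof -
  have "(\<lambda>z::real \<times> real. (1 / fst z, 1 / snd z)) \<in> borel_measurable borel"
    by (subst borel_prod[symmetric])+ measurable
  then have inv: "(\<lambda>z. (1 / fst z, 1 / snd z)) \<in> measurable Rpos2 Rpos2"
    unfolding Rpos2_def
    by (intro measurable_restrict_space3) auto
  have sp: "space Q = {0<..} \<times> {0<..}"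
    using sets_eq_imp_space_eq[OF assms(1)] by (simp add: Rpos2_def space_restrict_space)
  have inv': "(\<lambda>z. (1 / fst z, 1 / snd z)) \<in> measurable Q Rpos2"
    using inv measurable_cong_sets[OF assms(1) refl] by blast
  have id: "snd \<in> borel_measurable Q"
    unfolding measurable_cong_sets[OF assms(1) refl] Rpos2_def borel_prod[symmetric]
    by (intro measurable_restrict_space1) simp
  have fm: "(\<lambda>z. f (1 / fst z, 1 / snd z)) \<in> borel_measurable Q"
    using measurable_compose[OF inv' f] .
  have pos: "AE z in Q. 0 \<le> snd z"
    by (rule AE_I2) (auto simp: sp)
  have "(\<integral>z. f z \<partial>sym_plan Q) =
      (\<integral>z. f (1 / fst z, 1 / snd z) \<partial>density Q (\<lambda>z. ennreal (snd z)))"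
    unfolding sym_plan_def case_prod_beta using inv' f by (intro integral_distr) auto
  also have "\<dots> = (\<integral>z. snd z * f (1 / fst z, 1 / snd z) \<partial>Q)"
    using integral_density[OF fm id pos] by simp
  finally show ?thesis .
qed

end

theory Submission imports Defs begin

text \<open>
  The identities \<open>E[Y g(X)] = E[X g(X)]\<close> for \<open>g \<ge> 0\<close> express the martingale property. Under
  \<open>sym_plan\<close> both sides turn into \<open>E[g(1/X)]\<close>, so \<open>sym_plan\<close> is an involutive bijection between
  the martingale plans of \<open>\<mu>, \<nu>\<close> and those of \<open>sym_measure \<mu>, sym_measure \<nu>\<close>. Since
  \<open>t \<mapsto> 1 / t\<close> reverses the order of both coordinates, it swaps left and right monotonicity.
  Hence existence and uniqueness hold on one side iff they hold on the other, and the
  Beiglboeck--Juillet theorem itself is not needed: outside its range both plans are the null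
  measure, which \<open>sym_plan\<close> fixes.
\<close>

section \<open>Measurability on the half-line and the quadrant\<close>

lemma space_Rpos [simp]: "space Rpos = {0<..}"
  by (simp add: Rpos_def space_restrict_space)

lemma space_Rpos2 [simp]: "space Rpos2 = {0<..} \<times> {0<..}"
  by (simp add: Rpos2_def space_restrict_space)

lemma fst_measurable_Rpos2 [measurable]: "fst \<in> Rpos2 \<rightarrow>\<^sub>M Rpos"
  unfolding Rpos_def Rpos2_def
  by (intro measurable_restrict_space3) (auto simp: borel_prod[symmetric])

lemma snd_measurable_Rpos2 [measurable]: "snd \<in> Rpos2 \<rightarrow>\<^sub>M Rpos"
  unfolding Rpos_def Rpos2_def
  by (intro measurable_restrict_space3) (auto simp: borel_prod[symmetric])

lemma id_borel_measurable_Rpos: "(\<lambda>x. x) \<in> borel_measurable Rpos"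
  unfolding Rpos_def by (intro measurable_restrict_space1) simp

lemma ennreal_borel_measurable_Rpos [measurable]: "ennreal \<in> borel_measurable Rpos"
  using measurable_compose[OF id_borel_measurable_Rpos measurable_ennreal] .

lemma fst_borel_measurable_Rpos2 [measurable]: "fst \<in> borel_measurable Rpos2"
  using measurable_compose[OF fst_measurable_Rpos2 id_borel_measurable_Rpos] by simp

lemma snd_borel_measurable_Rpos2 [measurable]: "snd \<in> borel_measurable Rpos2"
  using measurable_compose[OF snd_measurable_Rpos2 id_borel_measurable_Rpos] by simp

lemma inverse_measurable_Rpos [measurable]: "(\<lambda>x. 1 / x) \<in> Rpos \<rightarrow>\<^sub>M Rpos"
  unfolding Rpos_def by (intro measurable_restrict_space3) auto

lemma inverse_measurable_Rpos2 [measurable]: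
  "(\<lambda>z. (1 / fst z, 1 / snd z)) \<in> Rpos2 \<rightarrow>\<^sub>M Rpos2"
proof -
  have "(\<lambda>z::real \<times> real. (1 / fst z, 1 / snd z)) \<in> borel_measurable borel"
    by (subst borel_prod[symmetric])+ measurable
  then show ?thesis
    unfolding Rpos2_def by (intro measurable_restrict_space3) auto
qed

section \<open>The symmetry operators as involutions\<close>

lemma sets_sym_measure [simp, measurable_cong]: "sets (sym_measure \<mu>) = sets Rpos"
  by (simp add: sym_measure_def)

lemma sets_sym_plan [simp, measurable_cong]: "sets (sym_plan Q) = sets Rpos2"
  by (simp add: sym_plan_def)

text \<open>Change of variables followed by the density formula. Extended nonnegative integrals
  carry no integrability conditions, so measures can be compared by inserting indicators.\<close>

lemma nn_integral_sym_measure: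
  fixes f :: "real \<Rightarrow> ennreal"
  assumes [measurable_cong]: "sets \<mu> = sets Rpos" and [measurable]: "f \<in> borel_measurable Rpos"
  shows "(\<integral>\<^sup>+ x. f x \<partial>sym_measure \<mu>) = (\<integral>\<^sup>+ x. ennreal x * f (1 / x) \<partial>\<mu>)"
  unfolding sym_measure_def by (subst nn_integral_distr; simp add: nn_integral_density)

lemma nn_integral_sym_plan:
  fixes f :: "real \<times> real \<Rightarrow> ennreal"
  assumes [measurable_cong]: "sets Q = sets Rpos2" and [measurable]: "f \<in> borel_measurable Rpos2"
  shows "(\<integral>\<^sup>+ z. f z \<partial>sym_plan Q) = (\<integral>\<^sup>+ z. ennreal (snd z) * f (1 / fst z, 1 / snd z) \<partial>Q)"
  unfolding sym_plan_def case_prod_beta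
  by (subst nn_integral_distr; simp add: nn_integral_density)

text \<open>Cancels the weights of two successive applications of the symmetry. The nested product
  is the shape those integrals take, and \<open>c\<close> may be infinite.\<close>

lemma ennreal_mult_one_divide:
  assumes "0 < (x::real)"
  shows "ennreal x * (ennreal (1 / x) * c) = c"
  using assms by (simp add: mult.assoc[symmetric] ennreal_mult[symmetric])

lemma sym_measure_sym_measure:
  assumes "sets \<mu> = sets Rpos"
  shows "sym_measure (sym_measure \<mu>) = \<mu>"
proof (rule measure_eqI)
  show "sets (sym_measure (sym_measure \<mu>)) = sets \<mu>"
    using assms by simp
  note [measurable_cong] = assms
  have sp: "space \<mu> = {0<..}"
    using sets_eq_imp_space_eq[OF assms] by simp
  fix A assume "A \<in> sets (sym_measure (sym_measure \<mu>))"
  then have [measurable]: "A \<in> sets Rpos" by simp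
  have "emeasure (sym_measure (sym_measure \<mu>)) A
      = (\<integral>\<^sup>+ x. indicator A x \<partial>sym_measure (sym_measure \<mu>))"
    by simp
  \<comment> \<open>With \<open>nn_integral_indicator\<close> active, simplification would fold the
    integral back into \<open>emeasure\<close> before \<open>nn_integral_sym_measure\<close> could
    act.\<close>
  also have "\<dots> = (\<integral>\<^sup>+ x. ennreal x * (ennreal (1 / x) * indicator A (1 / (1 / x))) \<partial>\<mu>)"
    using assms by (simp add: nn_integral_sym_measure del: divide_divide_eq_right nn_integral_indicator)
  also have "\<dots> = (\<integral>\<^sup>+ x. indicator A x \<partial>\<mu>)"
    by (intro nn_integral_cong) (simp only: sp greaterThan_iff ennreal_mult_one_divide, simp)
  finally show "emeasure (sym_measure (sym_measure \<mu>)) A = emeasure \<mu> A"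
    by simp
qed

lemma sym_plan_sym_plan:
  assumes "sets Q = sets Rpos2"
  shows "sym_plan (sym_plan Q) = Q"
proof (rule measure_eqI)
  show "sets (sym_plan (sym_plan Q)) = sets Q"
    using assms by simp
  note [measurable_cong] = assms
  have sp: "space Q = {0<..} \<times> {0<..}"
    using sets_eq_imp_space_eq[OF assms] by simp
  fix A assume "A \<in> sets (sym_plan (sym_plan Q))"
  then have [measurable]: "A \<in> sets Rpos2" by simp
  have "emeasure (sym_plan (sym_plan Q)) A = (\<integral>\<^sup>+ z. indicator A z \<partial>sym_plan (sym_plan Q))"
    by simp
  also have "\<dots> = (\<integral>\<^sup>+ z. ennreal (snd z) * (ennreal (1 / snd z) * indicator A z) \<partial>Q)"
    using assms by (simp add: nn_integral_sym_plan del: nn_integral_indicator)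
  also have "\<dots> = (\<integral>\<^sup>+ z. indicator A z \<partial>Q)"
    by (intro nn_integral_cong ennreal_mult_one_divide) (auto simp: sp)
  finally show "emeasure (sym_plan (sym_plan Q)) A = emeasure Q A"
    by simp
qed

section \<open>Stability of \<open>P1\<close> under the symmetry\<close>

lemma nn_integral_id_P1:
  assumes "\<nu> \<in> P1"
  shows "(\<integral>\<^sup>+ x. ennreal x \<partial>\<nu>) = 1"
proof -
  have sp: "space \<nu> = {0<..}"
    using assms sets_eq_imp_space_eq[of \<nu> Rpos] by (simp add: P1_def)
  have "has_bochner_integral \<nu> (\<lambda>x. x) 1"
    using assms by (simp add: P1_def)
  then show ?thesis
    by (subst nn_integral_eq_integral)
      (auto simp: has_bochner_integral_iff sp intro!: AE_I2)
qed

text \<open>The identity is positive on the half-line, so a finite extended integral already yields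
  Bochner integrability with the same value.\<close>

lemma P1_I:
  assumes "sets \<nu> = sets Rpos" "emeasure \<nu> (space \<nu>) = 1" "(\<integral>\<^sup>+ x. ennreal x \<partial>\<nu>) = 1"
  shows "\<nu> \<in> P1"
proof -
  have sp: "space \<nu> = {0<..}"
    using sets_eq_imp_space_eq[OF assms(1)] by simp
  have [measurable]: "(\<lambda>x. x) \<in> borel_measurable \<nu>"
    using id_borel_measurable_Rpos by (simp cong: measurable_cong_sets add: assms(1))
  have "has_bochner_integral \<nu> (\<lambda>x. x) 1"
    using assms(3) by (intro has_bochner_integral_nn_integral) (auto simp: sp intro!: AE_I2)
  then show ?thesis
    using assms by (simp add: P1_def prob_spaceI)
qed

text \<open>Mass and mean change places: the mass of the image is the mean of \<open>\<nu>\<close>,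
  and its mean is the mass of \<open>\<nu>\<close>.\<close>

lemma sym_measure_P1:
  assumes "\<nu> \<in> P1"
  shows "sym_measure \<nu> \<in> P1"
proof (rule P1_I)
  have sets: "sets \<nu> = sets Rpos" and "prob_space \<nu>"
    using assms by (auto simp: P1_def)
  then interpret prob_space \<nu> by simp
  have sp: "space \<nu> = {0<..}"
    using sets_eq_imp_space_eq[OF sets] by simp
  have "emeasure (sym_measure \<nu>) (space (sym_measure \<nu>)) = (\<integral>\<^sup>+ x. 1 \<partial>sym_measure \<nu>)"
    by simp
  also have "\<dots> = 1"
    using sets nn_integral_id_P1[OF assms] by (subst nn_integral_sym_measure) auto
  finally show "emeasure (sym_measure \<nu>) (space (sym_measure \<nu>)) = 1" .
  have "(\<integral>\<^sup>+ x. ennreal x \<partial>sym_measure \<nu>) = (\<integral>\<^sup>+ x. ennreal x * (ennreal (1 / x) * 1) \<partial>\<nu>)"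
    using sets by (subst nn_integral_sym_measure) auto
  also have "\<dots> = (\<integral>\<^sup>+ x. 1 \<partial>\<nu>)"
    by (intro nn_integral_cong ennreal_mult_one_divide) (simp add: sp)
  finally show "(\<integral>\<^sup>+ x. ennreal x \<partial>sym_measure \<nu>) = 1"
    by (simp add: emeasure_space_1)
qed simp

section \<open>The martingale property through test functions\<close>

lemma cond_exp_snd_eq_fst_iff:
  assumes "prob_space Q" and sets: "sets Q = sets Rpos2" and int: "integrable Q snd"
  shows "(AE z in Q. real_cond_exp Q (vimage_algebra (space Q) fst Rpos) snd z = fst z) \<longleftrightarrow>
    (\<forall>g\<in>borel_measurable Rpos. (\<integral>\<^sup>+ z. ennreal (snd z) * g (fst z) \<partial>Q)
                              = (\<integral>\<^sup>+ z. ennreal (fst z) * g (fst z) \<partial>Q))"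
    (is "?mart \<longleftrightarrow> ?test")
proof -
  interpret prob_space Q by fact
  let ?F = "vimage_algebra (space Q) fst Rpos"
  note [measurable_cong] = sets
  have sp: "space Q = {0<..} \<times> {0<..}"
    using sets_eq_imp_space_eq[OF sets] by simp
  have fst_meas: "fst \<in> Q \<rightarrow>\<^sub>M Rpos" by measurable
  have sub: "subalgebra Q ?F"
    unfolding subalgebra_def using sets_image_in_sets[OF refl fst_meas] by simp
  interpret finite_measure_subalgebra Q ?F
    by unfold_locales (fact sub)
  have sets_F: "sets ?F = {fst -` A \<inter> space Q |A. A \<in> sets Rpos}"
    by (rule sets_vimage_algebra2) (auto simp: sp)
  have F_fst: "fst \<in> borel_measurable ?F"
    by (rule measurable_compose[OF measurable_vimage_algebra1 id_borel_measurable_Rpos, simplified])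
      (auto simp: sp)
  \<comment> \<open>Bridge between the Bochner set integrals that characterise
    \<open>real_cond_exp\<close> and the extended integrals of the test identity.\<close>
  have nn_eq: "(\<integral>\<^sup>+ z. ennreal (h z) * indicator A (fst z) \<partial>Q)
      = ennreal (\<integral> z \<in> fst -` A \<inter> space Q. h z \<partial>Q)"
    if "integrable Q h" "\<And>z. z \<in> space Q \<Longrightarrow> 0 \<le> h z" "A \<in> sets Rpos" for h A
  proof -
    have [measurable]: "A \<in> sets Rpos" by fact
    have "fst -` A \<inter> space Q \<in> sets Q" by measurable
    then have "integrable Q (\<lambda>z. indicator (fst -` A \<inter> space Q) z *\<^sub>R h z)"
      using that(1) by (rule integrable_mult_indicator)
    then show ?thesis
      unfolding set_lebesgue_integral_def using that(2)
      by (subst nn_integral_eq_integral[symmetric])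
        (auto intro!: nn_integral_cong AE_I2 split: split_indicator)
  qed
  \<comment> \<open>Each side of the test identity is the integral of \<open>g\<close> against the
    first projection of a weighted \<open>Q\<close>, with weight \<open>snd\<close> or
    \<open>fst\<close>.\<close>
  have nn_distr: "(\<integral>\<^sup>+ x. g x \<partial>distr (density Q h) Rpos fst)
      = (\<integral>\<^sup>+ z. ennreal (h z) * g (fst z) \<partial>Q)"
    if [measurable]: "h \<in> borel_measurable Q" "g \<in> borel_measurable Rpos"
    for h :: "real \<times> real \<Rightarrow> real" and g :: "real \<Rightarrow> ennreal"
    by (subst nn_integral_distr; simp add: nn_integral_density)
  show ?thesis
  proof
    assume mart: ?mart
    have int_fst: "integrable Q fst"
      using real_cond_exp_int(1)[OF int] mart
      by (subst integrable_cong_AE[of _ _ "real_cond_exp Q ?F snd"]) auto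
    \<comment> \<open>Equality of these two measures extends the identity from indicators to all
      nonnegative \<open>g\<close>, replacing a monotone class argument.\<close>
    have "distr (density Q snd) Rpos fst = distr (density Q fst) Rpos fst"
    proof (rule measure_eqI)
      fix A assume "A \<in> sets (distr (density Q snd) Rpos fst)"
      then have A[measurable]: "A \<in> sets Rpos" by simp
      have A': "fst -` A \<inter> space Q \<in> sets Q" by measurable
      have "(\<integral> z \<in> fst -` A \<inter> space Q. snd z \<partial>Q)
          = (\<integral> z \<in> fst -` A \<inter> space Q. real_cond_exp Q ?F snd z \<partial>Q)"
        using int A by (intro real_cond_exp_intA) (auto simp: sp intro!: in_vimage_algebra)
      also have "\<dots> = (\<integral> z \<in> fst -` A \<inter> space Q. fst z \<partial>Q)"
        using mart A' by (intro set_lebesgue_integral_cong_AE) auto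
      finally have "(\<integral>\<^sup>+ z. ennreal (snd z) * indicator A (fst z) \<partial>Q)
          = (\<integral>\<^sup>+ z. ennreal (fst z) * indicator A (fst z) \<partial>Q)"
        using nn_eq[OF int _ A] nn_eq[OF int_fst _ A] by (auto simp: sp)
      then show "emeasure (distr (density Q snd) Rpos fst) A
          = emeasure (distr (density Q fst) Rpos fst) A"
        using nn_distr[of snd "indicator A"] nn_distr[of fst "indicator A"] by simp
    qed simp
    then show ?test
      using nn_distr[of snd] nn_distr[of fst] by simp
  next
    assume test: ?test
    \<comment> \<open>The constant test function 1 makes the means agree, so integrability passes
      from \<open>snd\<close> to \<open>fst\<close>.\<close>
    have "(\<integral>\<^sup>+ z. ennreal (fst z) \<partial>Q) = (\<integral>\<^sup>+ z. ennreal (snd z) \<partial>Q)"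
      using test[rule_format, of "\<lambda>_. 1"] by simp
    also have "\<dots> < \<infinity>"
      using int by (subst nn_integral_eq_integral) (auto simp: sp intro!: AE_I2)
    finally have int_fst: "integrable Q fst"
      by (intro integrableI_nonneg) (auto simp: sp intro!: AE_I2)
    show ?mart
    proof (rule real_cond_exp_charact[OF _ int int_fst F_fst])
      fix B assume "B \<in> sets ?F"
      then obtain A where A: "A \<in> sets Rpos" and B: "B = fst -` A \<inter> space Q"
        using sets_F by blast
      have "ennreal (\<integral> z \<in> B. snd z \<partial>Q) = ennreal (\<integral> z \<in> B. fst z \<partial>Q)"
        using nn_eq[OF int _ A] nn_eq[OF int_fst _ A] test[rule_format, of "indicator A"] A
        by (auto simp: sp B)
      \<comment> \<open>\<open>ennreal\<close> sends every negative real to 0, so it can be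
        cancelled only between nonnegative numbers.\<close>
      moreover have "0 \<le> (\<integral> z \<in> B. snd z \<partial>Q)" "0 \<le> (\<integral> z \<in> B. fst z \<partial>Q)"
        unfolding set_lebesgue_integral_def
        by (auto simp: sp intro!: Bochner_Integration.integral_nonneg split: split_indicator)
      ultimately show "(\<integral> z \<in> B. snd z \<partial>Q) = (\<integral> z \<in> B. fst z \<partial>Q)"
        by simp
    qed
  qed
qed

section \<open>Transport of martingale plans\<close>

lemma integrable_snd_martingale_plan:
  assumes "sets Q = sets Rpos2" "distr Q Rpos snd = \<nu>" "\<nu> \<in> P1"
  shows "integrable Q snd"
proof -
  note [measurable_cong] = assms(1)
  have "integrable (distr Q Rpos snd) (\<lambda>x. x)"
    using assms by (simp add: P1_def has_bochner_integral_iff)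
  then show ?thesis
    by (subst (asm) integrable_distr_eq) (auto intro: id_borel_measurable_Rpos)
qed

text \<open>The weight \<open>y\<close> is a function of the second coordinate, so the second
  marginal transforms directly. The first marginal calls for the weight \<open>x\<close> instead,
  and the martingale identity of \<open>Q\<close> supplies the exchange.\<close>

lemma sym_plan_martingale_plans:
  assumes "\<nu> \<in> P1" and Q: "Q \<in> martingale_plans \<mu> \<nu>"
  shows "sym_plan Q \<in> martingale_plans (sym_measure \<mu>) (sym_measure \<nu>)"
proof -
  have "prob_space Q" and sets: "sets Q = sets Rpos2"
    and \<mu>: "distr Q Rpos fst = \<mu>" and \<nu>: "distr Q Rpos snd = \<nu>"
    and mart: "AE z in Q. real_cond_exp Q (vimage_algebra (space Q) fst Rpos) snd z = fst z"
    using Q by (auto simp: martingale_plans_def)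
  then interpret prob_space Q by simp
  note [measurable_cong] = sets
  have sp: "space Q = {0<..} \<times> {0<..}"
    using sets_eq_imp_space_eq[OF sets] by simp
  have sets_\<mu>: "sets \<mu> = sets Rpos" and sets_\<nu>: "sets \<nu> = sets Rpos"
    using \<mu> \<nu> by auto
  have test: "(\<integral>\<^sup>+ z. ennreal (snd z) * g (fst z) \<partial>Q) = (\<integral>\<^sup>+ z. ennreal (fst z) * g (fst z) \<partial>Q)"
    if "g \<in> borel_measurable Rpos" for g
    using cond_exp_snd_eq_fst_iff[OF \<open>prob_space Q\<close> sets
        integrable_snd_martingale_plan[OF sets \<nu> assms(1)]] mart that by blast
  have sym_snd: "distr (sym_plan Q) Rpos snd = sym_measure \<nu>"
  proof (rule measure_eqI)
    fix A assume "A \<in> sets (distr (sym_plan Q) Rpos snd)"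
    then have [measurable]: "A \<in> sets Rpos" by simp
    have "emeasure (distr (sym_plan Q) Rpos snd) A
        = (\<integral>\<^sup>+ y. indicator A y \<partial>distr (sym_plan Q) Rpos snd)"
      by simp
    also have "\<dots> = (\<integral>\<^sup>+ z. indicator A (snd z) \<partial>sym_plan Q)"
      by (intro nn_integral_distr) auto
    also have "\<dots> = (\<integral>\<^sup>+ z. ennreal (snd z) * indicator A (1 / snd z) \<partial>Q)"
      using sets by (subst nn_integral_sym_plan) auto
    also have "\<dots> = (\<integral>\<^sup>+ y. ennreal y * indicator A (1 / y) \<partial>distr Q Rpos snd)"
      by (intro nn_integral_distr[symmetric]) auto
    also have "\<dots> = (\<integral>\<^sup>+ y. indicator A y \<partial>sym_measure \<nu>)"
      using sets_\<nu> \<nu> by (subst nn_integral_sym_measure) auto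
    finally show "emeasure (distr (sym_plan Q) Rpos snd) A = emeasure (sym_measure \<nu>) A"
      by simp
  qed simp
  have sym_fst: "distr (sym_plan Q) Rpos fst = sym_measure \<mu>"
  proof (rule measure_eqI)
    fix A assume "A \<in> sets (distr (sym_plan Q) Rpos fst)"
    then have [measurable]: "A \<in> sets Rpos" by simp
    have "emeasure (distr (sym_plan Q) Rpos fst) A
        = (\<integral>\<^sup>+ x. indicator A x \<partial>distr (sym_plan Q) Rpos fst)"
      by simp
    also have "\<dots> = (\<integral>\<^sup>+ z. indicator A (fst z) \<partial>sym_plan Q)"
      by (intro nn_integral_distr) auto
    also have "\<dots> = (\<integral>\<^sup>+ z. ennreal (snd z) * indicator A (1 / fst z) \<partial>Q)"
      using sets by (subst nn_integral_sym_plan) auto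
    \<comment> \<open>The remaining factor depends on \<open>x\<close> alone, so the martingale
      identity may replace the weight \<open>y\<close> by \<open>x\<close>.\<close>
    also have "\<dots> = (\<integral>\<^sup>+ z. ennreal (fst z) * indicator A (1 / fst z) \<partial>Q)"
      by (rule test) measurable
    also have "\<dots> = (\<integral>\<^sup>+ x. ennreal x * indicator A (1 / x) \<partial>distr Q Rpos fst)"
      by (intro nn_integral_distr[symmetric]) auto
    also have "\<dots> = (\<integral>\<^sup>+ x. indicator A x \<partial>sym_measure \<mu>)"
      using sets_\<mu> \<mu> by (subst nn_integral_sym_measure) auto
    finally show "emeasure (distr (sym_plan Q) Rpos fst) A = emeasure (sym_measure \<mu>) A"
      by simp
  qed simp
  have sym_P1: "sym_measure \<nu> \<in> P1"
    by (rule sym_measure_P1[OF assms(1)])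
  \<comment> \<open>Total mass 1 is read off from the second marginal, since projecting preserves
    mass.\<close>
  have "prob_space (distr (sym_plan Q) Rpos snd)"
    using sym_P1 by (simp add: sym_snd P1_def)
  then have sym_prob: "prob_space (sym_plan Q)"
    by (rule prob_space_distrD[rotated]) measurable
  have "(\<integral>\<^sup>+ z. ennreal (snd z) * g (fst z) \<partial>sym_plan Q)
      = (\<integral>\<^sup>+ z. ennreal (fst z) * g (fst z) \<partial>sym_plan Q)"
    if [measurable]: "g \<in> borel_measurable Rpos" for g
  proof -
    have "(\<integral>\<^sup>+ z. ennreal (snd z) * g (fst z) \<partial>sym_plan Q)
        = (\<integral>\<^sup>+ z. ennreal (snd z) * (ennreal (1 / snd z) * g (1 / fst z)) \<partial>Q)"
      using sets by (subst nn_integral_sym_plan) auto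
    also have "\<dots> = (\<integral>\<^sup>+ z. g (1 / fst z) \<partial>Q)"
      by (intro nn_integral_cong ennreal_mult_one_divide) (auto simp: sp)
    \<comment> \<open>Inserting \<open>x * (1 / x)\<close> creates a weight \<open>x\<close>, which
      the martingale identity for \<open>(1 / x) * g (1 / x)\<close> converts into the weight
      \<open>y\<close> carried by \<open>sym_plan\<close>.\<close>
    also have "\<dots> = (\<integral>\<^sup>+ z. ennreal (fst z) * (ennreal (1 / fst z) * g (1 / fst z)) \<partial>Q)"
      by (intro nn_integral_cong ennreal_mult_one_divide[symmetric]) (auto simp: sp)
    also have "\<dots> = (\<integral>\<^sup>+ z. ennreal (snd z) * (ennreal (1 / fst z) * g (1 / fst z)) \<partial>Q)"
      by (rule test[symmetric]) measurable
    also have "\<dots> = (\<integral>\<^sup>+ z. ennreal (fst z) * g (fst z) \<partial>sym_plan Q)"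
      using sets by (subst nn_integral_sym_plan) auto
    finally show ?thesis .
  qed
  then have "AE z in sym_plan Q.
      real_cond_exp (sym_plan Q) (vimage_algebra (space (sym_plan Q)) fst Rpos) snd z = fst z"
    using cond_exp_snd_eq_fst_iff[OF sym_prob _
        integrable_snd_martingale_plan[OF _ sym_snd sym_P1]] by simp
  then show ?thesis
    using sym_prob sym_fst sym_snd by (simp add: martingale_plans_def)
qed

text \<open>The operator is its own inverse, so one inclusion, used for the given marginals and
  again for their images, gives both directions.\<close>

lemma bij_betw_sym_plan_martingale_plans:
  assumes "\<mu> \<in> P1" "\<nu> \<in> P1"
  shows "bij_betw sym_plan (martingale_plans (sym_measure \<mu>) (sym_measure \<nu>)) (martingale_plans \<mu> \<nu>)"
proof (rule bij_betw_byWitness[where f' = sym_plan])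
  have sets: "sets \<mu> = sets Rpos" "sets \<nu> = sets Rpos"
    using assms by (auto simp: P1_def)
  show "sym_plan ` martingale_plans \<mu> \<nu> \<subseteq> martingale_plans (sym_measure \<mu>) (sym_measure \<nu>)"
    using sym_plan_martingale_plans assms by blast
  show "sym_plan ` martingale_plans (sym_measure \<mu>) (sym_measure \<nu>) \<subseteq> martingale_plans \<mu> \<nu>"
    using sym_plan_martingale_plans[OF sym_measure_P1[OF assms(2)], of _ "sym_measure \<mu>"] sets
    by (auto simp: sym_measure_sym_measure)
qed (auto simp: martingale_plans_def sym_plan_sym_plan)

section \<open>Exchange of left and right monotonicity\<close>

text \<open>Coordinate inversion is an involution of the quadrant, so the preimage
  \<open>\<Gamma>'\<close> is also the image of \<open>\<Gamma>\<close>. Its mass is the integral of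
  the weight \<open>y\<close> over almost all of \<open>Q\<close>, which is the mean of
  \<open>\<nu>\<close>.\<close>

lemma emeasure_sym_plan_inverse:
  assumes Q: "Q \<in> martingale_plans \<mu> \<nu>" and "\<nu> \<in> P1"
    and \<Gamma>[measurable]: "\<Gamma> \<in> sets Rpos2" and "emeasure Q \<Gamma> = 1"
  defines "\<Gamma>' \<equiv> (\<lambda>z. (1 / fst z, 1 / snd z)) -` \<Gamma> \<inter> space Rpos2"
  shows "\<Gamma>' \<in> sets Rpos2" and "emeasure (sym_plan Q) \<Gamma>' = 1"
proof -
  show \<Gamma>'[measurable]: "\<Gamma>' \<in> sets Rpos2"
    unfolding \<Gamma>'_def by measurable
  have "prob_space Q" and sets: "sets Q = sets Rpos2" and \<nu>: "distr Q Rpos snd = \<nu>"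
    using Q by (auto simp: martingale_plans_def)
  then interpret prob_space Q by simp
  note [measurable_cong] = sets
  have sp: "space Q = {0<..} \<times> {0<..}"
    using sets_eq_imp_space_eq[OF sets] by simp
  have ae: "AE z in Q. z \<in> \<Gamma>"
    using \<open>emeasure Q \<Gamma> = 1\<close> \<Gamma> sets by (subst AE_in_set_eq_1) (auto simp: measure_def)
  have "emeasure (sym_plan Q) \<Gamma>' = (\<integral>\<^sup>+ z. indicator \<Gamma>' z \<partial>sym_plan Q)"
    by simp
  also have "\<dots> = (\<integral>\<^sup>+ z. ennreal (snd z) * indicator \<Gamma>' (1 / fst z, 1 / snd z) \<partial>Q)"
    using sets by (subst nn_integral_sym_plan) auto
  also have "\<dots> = (\<integral>\<^sup>+ z. ennreal (snd z) \<partial>Q)"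
  proof (rule nn_integral_cong_AE)
    show "AE z in Q. ennreal (snd z) * indicator \<Gamma>' (1 / fst z, 1 / snd z) = ennreal (snd z)"
      using ae AE_space by eventually_elim (auto simp: sp \<Gamma>'_def)
  qed
  also have "\<dots> = (\<integral>\<^sup>+ y. ennreal y \<partial>distr Q Rpos snd)"
    by (intro nn_integral_distr[symmetric]) auto
  also have "\<dots> = 1"
    using nn_integral_id_P1[OF \<open>\<nu> \<in> P1\<close>] by (simp add: \<nu>)
  finally show "emeasure (sym_plan Q) \<Gamma>' = 1" .
qed

text \<open>Inversion flips the order of the two first coordinates, while strict betweenness of the
  second coordinates survives with its outer points interchanged.\<close>

lemma sym_plan_left_monotone:
  assumes "Q \<in> martingale_plans \<mu> \<nu>" "\<nu> \<in> P1" "left_monotone Q"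
  shows "right_monotone (sym_plan Q)"
proof -
  obtain \<Gamma> where \<Gamma>: "\<Gamma> \<in> sets Rpos2" "emeasure Q \<Gamma> = 1"
    and mono: "\<And>x ym yp x' y'. (x, ym) \<in> \<Gamma> \<Longrightarrow> (x, yp) \<in> \<Gamma> \<Longrightarrow> (x', y') \<in> \<Gamma> \<Longrightarrow>
      \<not> (x < x' \<and> ym < y' \<and> y' < yp)"
    using assms(3) unfolding left_monotone_def by metis
  let ?\<Gamma>' = "(\<lambda>z. (1 / fst z, 1 / snd z)) -` \<Gamma> \<inter> space Rpos2"
  show ?thesis
    unfolding right_monotone_def
  proof (rule bexI[of _ ?\<Gamma>'], intro conjI allI impI notI)
    fix x ym yp x' y' :: real
    assume \<Gamma>': "(x, ym) \<in> ?\<Gamma>' \<and> (x, yp) \<in> ?\<Gamma>' \<and> (x', y') \<in> ?\<Gamma>'"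
      and less: "x' < x \<and> ym < y' \<and> y' < yp"
    then have "0 < x" "0 < x'" "0 < ym" "0 < y'" "0 < yp"
      by simp_all
    with less have "1 / x < 1 / x'" "1 / yp < 1 / y'" "1 / y' < 1 / ym"
      by (simp_all add: frac_less2)
    \<comment> \<open>The lower point for \<open>\<Gamma>\<close> is \<open>1 / yp\<close> and the
      upper one is \<open>1 / ym\<close>.\<close>
    then show False
      using mono[of "1 / x" "1 / yp" "1 / ym" "1 / x'" "1 / y'"] \<Gamma>' by simp
  qed (fact emeasure_sym_plan_inverse[OF assms(1,2) \<Gamma>])+
qed

lemma sym_plan_right_monotone:
  assumes "Q \<in> martingale_plans \<mu> \<nu>" "\<nu> \<in> P1" "right_monotone Q"
  shows "left_monotone (sym_plan Q)"
proof -
  obtain \<Gamma> where \<Gamma>: "\<Gamma> \<in> sets Rpos2" "emeasure Q \<Gamma> = 1"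
    and mono: "\<And>x ym yp x' y'. (x, ym) \<in> \<Gamma> \<Longrightarrow> (x, yp) \<in> \<Gamma> \<Longrightarrow> (x', y') \<in> \<Gamma> \<Longrightarrow>
      \<not> (x > x' \<and> ym < y' \<and> y' < yp)"
    using assms(3) unfolding right_monotone_def by metis
  let ?\<Gamma>' = "(\<lambda>z. (1 / fst z, 1 / snd z)) -` \<Gamma> \<inter> space Rpos2"
  show ?thesis
    unfolding left_monotone_def
  proof (rule bexI[of _ ?\<Gamma>'], intro conjI allI impI notI)
    fix x ym yp x' y' :: real
    assume \<Gamma>': "(x, ym) \<in> ?\<Gamma>' \<and> (x, yp) \<in> ?\<Gamma>' \<and> (x', y') \<in> ?\<Gamma>'"
      and less: "x < x' \<and> ym < y' \<and> y' < yp"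
    then have "0 < x" "0 < x'" "0 < ym" "0 < y'" "0 < yp"
      by simp_all
    with less have "1 / x' < 1 / x" "1 / yp < 1 / y'" "1 / y' < 1 / ym"
      by (simp_all add: frac_less2)
    then show False
      using mono[of "1 / x" "1 / yp" "1 / ym" "1 / x'" "1 / y'"] \<Gamma>' by simp
  qed (fact emeasure_sym_plan_inverse[OF assms(1,2) \<Gamma>])+
qed

section \<open>Transfer of the unique monotone plans\<close>

lemma sym_plan_null_measure: "sym_plan (null_measure Rpos2) = null_measure Rpos2"
proof (rule measure_eqI)
  fix A assume "A \<in> sets (sym_plan (null_measure Rpos2))"
  then have [measurable]: "A \<in> sets Rpos2" by simp
  have "emeasure (sym_plan (null_measure Rpos2)) A
      = (\<integral>\<^sup>+ z. indicator A z \<partial>sym_plan (null_measure Rpos2))"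
    by simp
  also have "\<dots> = 0"
    by (subst nn_integral_sym_plan) auto
  finally show "emeasure (sym_plan (null_measure Rpos2)) A = emeasure (null_measure Rpos2) A"
    by simp
qed simp

text \<open>A bijection matching two predicates restricts to a bijection of their solution sets and
  so carries a unique solution to the unique solution. The conditional form, with defaults matched
  by \<open>f c = d\<close>, is that of \<open>Q_L\<close> and \<open>Q_R\<close>.\<close>

lemma the1_else_bij_betw:
  assumes bij: "bij_betw f A B" and PR: "\<And>a. a \<in> A \<Longrightarrow> P a \<longleftrightarrow> R (f a)" and "f c = d"
  shows "f (if \<exists>!a. a \<in> A \<and> P a then THE a. a \<in> A \<and> P a else c)
       = (if \<exists>!b. b \<in> B \<and> R b then THE b. b \<in> B \<and> R b else d)"
proof -
  have inj: "inj_on f A" and B: "B = f ` A"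
    using bij by (auto simp: bij_betw_def)
  have "{b \<in> B. R b} = f ` {a \<in> A. P a}"
    using PR by (auto simp: B)
  moreover have "inj_on f {a \<in> A. P a}"
    using inj by (rule inj_on_subset) auto
  \<comment> \<open>Unique existence becomes \<open>card = 1\<close>; infinite sets have
    \<open>card\<close> 0 and cause no confusion.\<close>
  ultimately have "card {b \<in> B. R b} = card {a \<in> A. P a}"
    by (simp add: card_image)
  then have ex1: "(\<exists>!b. b \<in> B \<and> R b) \<longleftrightarrow> (\<exists>!a. a \<in> A \<and> P a)"
    using is_singleton_iff_ex1[of "{b \<in> B. R b}"] is_singleton_iff_ex1[of "{a \<in> A. P a}"]
    by (simp add: is_singleton_altdef)
  show ?thesis
  proof (cases "\<exists>!a. a \<in> A \<and> P a")
    case True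
    then have a: "(THE a. a \<in> A \<and> P a) \<in> A \<and> P (THE a. a \<in> A \<and> P a)"
      by (rule theI')
    then have "f (THE a. a \<in> A \<and> P a) \<in> B \<and> R (f (THE a. a \<in> A \<and> P a))"
      using PR by (auto simp: B)
    then have "(THE b. b \<in> B \<and> R b) = f (THE a. a \<in> A \<and> P a)"
      using iffD2[OF ex1 True] by (intro the1_equality)
    then show ?thesis
      using True ex1 by simp
  next
    case False
    then show ?thesis
      using ex1 \<open>f c = d\<close> by simp
  qed
qed

theorem mainTheorem3:
  fixes \<mu> \<nu> :: "real measure"
  assumes "\<mu> \<in> P1" and "\<nu> \<in> P1" and "\<mu> \<preceq>\<^sub>c \<nu>"
  shows "sym_plan (Q_R (sym_measure \<mu>) (sym_measure \<nu>)) = Q_L \<mu> \<nu> \<and>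
         sym_plan (Q_L (sym_measure \<mu>) (sym_measure \<nu>)) = Q_R \<mu> \<nu>"
proof -
  let ?M = "martingale_plans (sym_measure \<mu>) (sym_measure \<nu>)"
  have bij: "bij_betw sym_plan ?M (martingale_plans \<mu> \<nu>)"
    by (rule bij_betw_sym_plan_martingale_plans[OF assms(1,2)])
  have invol: "sym_plan (sym_plan Q) = Q" if "Q \<in> ?M" for Q
    using that by (simp add: martingale_plans_def sym_plan_sym_plan)
  have \<nu>': "sym_measure \<nu> \<in> P1"
    by (rule sym_measure_P1[OF assms(2)])
  \<comment> \<open>One implication is direct. The converse applies the mirrored lemma to
    \<open>sym_plan Q\<close> and returns to \<open>Q\<close> by \<open>invol\<close>.\<close>
  have RL: "right_monotone Q \<longleftrightarrow> left_monotone (sym_plan Q)" if "Q \<in> ?M" for Q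
    using sym_plan_right_monotone[OF that \<nu>'] invol[OF that]
      sym_plan_left_monotone[OF bij_betwE[OF bij, rule_format, OF that] assms(2)] by auto
  have LR: "left_monotone Q \<longleftrightarrow> right_monotone (sym_plan Q)" if "Q \<in> ?M" for Q
    using sym_plan_left_monotone[OF that \<nu>'] invol[OF that]
      sym_plan_right_monotone[OF bij_betwE[OF bij, rule_format, OF that] assms(2)] by auto
  show ?thesis
    unfolding Q_L_def Q_R_def
    by (intro conjI the1_else_bij_betw[where f = sym_plan] bij RL LR sym_plan_null_measure)
qed

end
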